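(* Let $w$ be a permutation. The following are equivalent: (1) $\mathrm{SD}(w)=P(w)$; (2) $\mathrm{SD}(w)$ is a standard tableau; (3) the shape of $\mathrm{SD}(w)$ equals the shape of $P(w)$.
   Context: Box-ball system (BBS): boxes are arranged in a row extending infinitely to the right, each box holds at most one ball, and the balls are labeled $1,\dots,n$. A permutation $w=w_1\cdots w_n\in S_n$ gives the configuration at time $0$, with ball $w_i$ in the $i$-th of $n$ consecutive boxes and all other boxes empty. A BBS move consists of moving ball $1$ to the nearest empty box to its right, then ball $2$, and so on up to ball $n$. The state at time $t$ is obtained from the time-$0$ state by $t$ BBS moves. An increasing run of a configuration is a maximal block of balls in consecutive boxes whose labels increase from left to right. A soliton is an increasing run which is preserved by all subsequent BBS moves (its balls stay in consecutive boxes in the same increasing order, and the runs keep their relative order). After finitely many moves the system reaches a steady state, in which all increasing runs are solitons and their lengths weakly decrease from right to left. The soliton decomposition $\mathrm{SD}(w)$ is the tableau (English notation) whose first row is the rightmost soliton of a steady-state configuration of the system started at $w$, whose second row is the soliton immediately to its left, and so on; its rows are increasing but its columns need not be. $P(w)$ denotes the Robinson–Schensted insertion tableau of $w$. *)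

theory Defs
  imports Main "HOL-Combinatorics.Multiset_Permutations"
begin

section \<open>The box-ball system\<close>

text \<open>Boxes are indexed by the natural numbers from left to right; \<open>c i = Some k\<close> means that box
  \<open>i\<close> holds ball \<open>k\<close>, and \<open>c i = None\<close> that it is empty.\<close>

type_synonym config = "nat \<Rightarrow> nat option"

definition initial_config :: "nat list \<Rightarrow> config" where
  "initial_config w = (\<lambda>i. if i < length w then Some (w ! i) else None)"

definition ball_position :: "config \<Rightarrow> nat \<Rightarrow> nat" where
  "ball_position c k = (THE i. c i = Some k)"

definition move_ball :: "nat \<Rightarrow> config \<Rightarrow> config" where
  "move_ball k c =
     (let p = ball_position c k; q = (LEAST q. p < q \<and> c q = None)
      in c(p := None, q := Some k))"

definition bbs_move :: "nat \<Rightarrow> config \<Rightarrow> config" where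
  "bbs_move n c = fold move_ball [1..<Suc n] c"

definition bbs_state :: "nat list \<Rightarrow> nat \<Rightarrow> config" where
  "bbs_state w t = (bbs_move (length w) ^^ t) (initial_config w)"


section \<open>Increasing runs, solitons and the soliton decomposition\<close>

text \<open>Blocks are half-open intervals of boxes \<open>{a..<b}\<close>.\<close>

definition block_labels :: "config \<Rightarrow> nat \<Rightarrow> nat \<Rightarrow> nat list" where
  "block_labels c a b = map (\<lambda>i. the (c i)) [a..<b]"

definition increasing_block :: "config \<Rightarrow> nat \<Rightarrow> nat \<Rightarrow> bool" where
  "increasing_block c a b \<longleftrightarrow>
     a < b \<and> (\<forall>i\<in>{a..<b}. c i \<noteq> None) \<and> sorted_wrt (<) (block_labels c a b)"

definition increasing_run :: "config \<Rightarrow> nat \<Rightarrow> nat \<Rightarrow> bool" where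
  "increasing_run c a b \<longleftrightarrow>
     increasing_block c a b \<and>
     (\<forall>a' b'. a' \<le> a \<and> b \<le> b' \<and> increasing_block c a' b' \<longrightarrow> a' = a \<and> b' = b)"

text \<open>The label sequences of all increasing runs, listed from left to right. A run is determined by
  its leftmost box, and there are only finitely many runs because there are finitely many balls.\<close>

definition run_list :: "config \<Rightarrow> nat list list" where
  "run_list c =
     map (\<lambda>a. block_labels c a (THE b. increasing_run c a b))
       (sorted_list_of_set {a. \<exists>b. increasing_run c a b})"

definition soliton :: "nat list \<Rightarrow> nat \<Rightarrow> nat list \<Rightarrow> bool" where
  "soliton w t r \<longleftrightarrow> (\<forall>t'\<ge>t. r \<in> set (run_list (bbs_state w t')))"

text \<open>The second conjunct is the requirement that the solitons keep their relative order. It makes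
  \<open>run_list\<close> constant from time \<open>t\<close> on, so all steady states have the same run list.\<close>

definition steady_state :: "nat list \<Rightarrow> nat \<Rightarrow> bool" where
  "steady_state w t \<longleftrightarrow>
     (\<forall>r \<in> set (run_list (bbs_state w t)). soliton w t r) \<and>
     (\<forall>t'\<ge>t. run_list (bbs_state w t') = run_list (bbs_state w t)) \<and>
     sorted (map length (run_list (bbs_state w t)))"

text \<open>Tableaux are lists of rows, top row first. The top row of \<open>SD w\<close> is the rightmost soliton,
  hence the reversal.\<close>

type_synonym tableau = "nat list list"

definition SD :: "nat list \<Rightarrow> tableau" where
  "SD w = rev (run_list (bbs_state w (SOME t. steady_state w t)))"


section \<open>Tableaux and Robinson--Schensted insertion\<close>

definition shape :: "tableau \<Rightarrow> nat list" where
  "shape T = map length T"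

definition standard_tableau :: "tableau \<Rightarrow> bool" where
  "standard_tableau T \<longleftrightarrow>
     [] \<notin> set T \<and> sorted_wrt (\<ge>) (shape T) \<and>
     distinct (concat T) \<and> set (concat T) = {1..length (concat T)} \<and>
     (\<forall>r \<in> set T. sorted_wrt (<) r) \<and>
     (\<forall>i j. Suc i < length T \<and> j < length (T ! Suc i) \<longrightarrow> T ! i ! j < T ! Suc i ! j)"

text \<open>Inserting \<open>x\<close> into a row replaces the leftmost entry greater than \<open>x\<close>, which is returned as
  the bumped entry; if there is none, \<open>x\<close> is appended.\<close>

fun row_insert :: "nat \<Rightarrow> nat list \<Rightarrow> nat option \<times> nat list" where
  "row_insert x [] = (None, [x])"
| "row_insert x (y # ys) =
     (if x < y then (Some y, x # ys)
      else (let (b, r) = row_insert x ys in (b, y # r)))"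

fun tableau_insert :: "nat \<Rightarrow> tableau \<Rightarrow> tableau" where
  "tableau_insert x [] = [[x]]"
| "tableau_insert x (r # rs) =
     (case row_insert x r of
        (None, r') \<Rightarrow> r' # rs
      | (Some y, r') \<Rightarrow> r' # tableau_insert y rs)"

definition P_tableau :: "nat list \<Rightarrow> tableau" where
  "P_tableau w = fold tableau_insert w []"

end

theory Submission imports Defs begin

text \<open>Reading the balls of a state from left to right gives a word, and a box-ball move can be
  performed by a carrier that travels along the boxes and whose load behaves like a row under row
  insertion. Row bumping is a composition of Knuth moves, so the insertion tableau of the word is the
  same at all times (Fukuda). The word of a state is also the reading word of the tableau of its
  increasing runs, hence \<open>P_tableau w\<close> is the insertion tableau of the reading word of \<open>SD w\<close>. If
  \<open>SD w\<close> is standard, that insertion tableau is \<open>SD w\<close> itself. Conversely, inserting an increasing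
  row adds a horizontal strip; if the final shape is that of \<open>SD w\<close>, interlacing forces each row,
  when inserted, to bump the whole row inserted before it, and this means that columns increase.

  None of this depends on the time at which the state is observed, so the choice of a steady state
  in \<open>SD\<close>, and even the existence of one, is irrelevant.\<close>

section \<open>Row insertion\<close>

lemma row_insert_append:
  "\<forall>a\<in>set p. a \<le> x \<Longrightarrow> row_insert x (p @ s) = apsnd ((@) p) (row_insert x s)"
  by (induction p) (auto simp: apsnd_def map_prod_def split: prod.splits)

lemma row_insert_greatest: "\<forall>a\<in>set p. a \<le> x \<Longrightarrow> row_insert x p = (None, p @ [x])"
  using row_insert_append[of p x "[]"] by simp

lemma row_insert_NoneD:
  "row_insert x r = (None, r') \<Longrightarrow> (\<forall>a\<in>set r. a \<le> x) \<and> r' = r @ [x]"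
  by (induction r arbitrary: r') (auto split: prod.splits if_splits)

lemma row_insert_SomeE:
  assumes "row_insert x r = (Some y, r')"
  obtains p q where "r = p @ y # q" "r' = p @ x # q" "\<forall>a\<in>set p. a \<le> x" "x < y"
proof -
  have "\<exists>p q. r = p @ y # q \<and> r' = p @ x # q \<and> (\<forall>a\<in>set p. a \<le> x) \<and> x < y"
    using assms
  proof (induction r arbitrary: r')
    case (Cons z r)
    show ?case
    proof (cases "x < z")
      case True
      with Cons.prems show ?thesis by (intro exI[of _ "[]"] exI[of _ r]) auto
    next
      case False
      with Cons.prems obtain r1 where r1: "row_insert x r = (Some y, r1)" "r' = z # r1"
        by (auto split: prod.splits)
      from Cons.IH[OF r1(1)] obtain p q where
        "r = p @ y # q" "r1 = p @ x # q" "\<forall>a\<in>set p. a \<le> x" "x < y" by blast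
      with False r1 show ?thesis by (intro exI[of _ "z # p"] exI[of _ q]) auto
    qed
  qed simp
  then show thesis using that by blast
qed

text \<open>The first component collects the bumped entries in the order of bumping: it is the word
  that reaches the next row.\<close>

fun row_inserts :: "nat list \<Rightarrow> nat list \<Rightarrow> nat list \<times> nat list" where
  "row_inserts [] r = ([], r)"
| "row_inserts (x # xs) r =
     (let (b, r1) = row_insert x r; (bs, r2) = row_inserts xs r1
      in (case b of None \<Rightarrow> bs | Some y \<Rightarrow> y # bs, r2))"

text \<open>A row never depends on the rows below it, so a whole word can pass through the first row
  before any bumped letter enters the others.\<close>

lemma fold_tableau_insert_Cons:
  "fold tableau_insert xs (r # rs) =
     snd (row_inserts xs r) # fold tableau_insert (fst (row_inserts xs r)) rs"
  by (induction xs arbitrary: r rs) (auto simp: Let_def split: prod.splits option.splits)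

text \<open>A missing row behaves like an empty one, so the row-by-row description also applies
  below the last row.\<close>

lemma fold_tableau_insert_Nil:
  "xs \<noteq> [] \<Longrightarrow> fold tableau_insert xs [] = fold tableau_insert xs [[]]"
  by (cases xs) auto

section \<open>Content and sortedness under insertion\<close>

lemma mset_row_insert:
  "row_insert x r = (b, r') \<Longrightarrow> mset r' + (case b of None \<Rightarrow> {#} | Some y \<Rightarrow> {#y#}) = add_mset x (mset r)"
  by (cases b) (auto dest: row_insert_NoneD elim: row_insert_SomeE)

lemma length_row_inserts:
  "length (fst (row_inserts xs r)) + length (snd (row_inserts xs r)) = length xs + length r"
proof (induction xs arbitrary: r)
  case (Cons x xs)
  obtain b r1 where b: "row_insert x r = (b, r1)" by fastforce
  have "size (mset r1 + (case b of None \<Rightarrow> {#} | Some y \<Rightarrow> {#y#})) = Suc (length r)"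
    using mset_row_insert[OF b] by simp
  then show ?case using Cons[of r1] b by (cases b) (auto split: prod.splits)
qed simp

lemma sorted_row_insert: "sorted r \<Longrightarrow> sorted (snd (row_insert x r))"
proof (cases "row_insert x r")
  case (Pair b r')
  assume "sorted r"
  then show ?thesis
    using Pair
    by (cases b) (fastforce dest: row_insert_NoneD elim: row_insert_SomeE simp: sorted_append)+
qed

lemma sorted_tableau_insert:
  "\<forall>r\<in>set T. sorted r \<Longrightarrow> \<forall>r\<in>set (tableau_insert x T). sorted r"
proof (induction T arbitrary: x)
  case (Cons r T)
  obtain b r' where b: "row_insert x r = (b, r')" by fastforce
  then have "sorted r'" using sorted_row_insert[of r x] Cons.prems by simp
  with Cons b show ?case by (auto split: option.splits)
qed simp

lemma sorted_fold_tableau_insert: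
  "\<forall>r\<in>set T. sorted r \<Longrightarrow> \<forall>r\<in>set (fold tableau_insert xs T). sorted r"
proof (induction xs arbitrary: T)
  case (Cons x xs)
  from Cons.IH[OF sorted_tableau_insert[OF Cons.prems]] show ?case by simp
qed simp

lemma mset_concat_tableau_insert:
  "mset (concat (tableau_insert x T)) = add_mset x (mset (concat T))"
proof (induction T arbitrary: x)
  case (Cons r T)
  then show ?case
    by (auto split: prod.splits option.splits dest!: mset_row_insert)
qed simp

lemma mset_concat_fold_tableau_insert:
  "mset (concat (fold tableau_insert xs T)) = mset xs + mset (concat T)"
  by (induction xs arbitrary: T) (simp_all add: mset_concat_tableau_insert)

lemma mset_concat_P_tableau: "mset (concat (P_tableau w)) = mset w"
  by (simp add: P_tableau_def mset_concat_fold_tableau_insert)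


section \<open>Knuth relations\<close>

text \<open>The elementary Knuth relations for words with repeated letters, oriented one way; the
  converse is listed separately where it can occur.\<close>

inductive knuth :: "nat list \<Rightarrow> nat list \<Rightarrow> bool" where
  knuth1: "x < y \<Longrightarrow> y \<le> z \<Longrightarrow> knuth [y, x, z] [y, z, x]"
| knuth2: "x \<le> y \<Longrightarrow> y < z \<Longrightarrow> knuth [x, z, y] [z, x, y]"

lemma knuth_triple:
  "knuth [a, b, c] [d, e, f] \<longleftrightarrow>
     a = d \<and> b = f \<and> c = e \<and> b < a \<and> a \<le> c \<or> a = e \<and> b = d \<and> c = f \<and> a \<le> c \<and> c < b"
  by (auto simp: knuth.simps)

lemma sorted_split:
  assumes "sorted (r :: nat list)"
  obtains p s where "r = p @ s" "\<forall>a\<in>set p. a \<le> x" "\<forall>a\<in>set s. x < a" "sorted s"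
proof -
  have "\<exists>p s. r = p @ s \<and> (\<forall>a\<in>set p. a \<le> x) \<and> (\<forall>a\<in>set s. x < a) \<and> sorted s"
    using assms
  proof (induction r)
    case (Cons y r)
    show ?case
    proof (cases "y \<le> x")
      case True
      from Cons obtain p s where "r = p @ s" "\<forall>a\<in>set p. a \<le> x" "\<forall>a\<in>set s. x < a" "sorted s"
        by auto
      with True show ?thesis by (intro exI[of _ "y # p"] exI[of _ s]) auto
    next
      case False
      with Cons.prems show ?thesis by (intro exI[of _ "[]"] exI[of _ "y # r"]) auto
    qed
  qed simp
  then show thesis using that by blast
qed

text \<open>The three letters cut the sorted row into four segments, and insertion changes at most
  the first two entries of a segment, so finitely many cases remain according to how short the
  segments are. The bumped words may be related in the reverse orientation, hence the last
  alternative.\<close>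

lemma row_inserts_knuth:
  assumes "knuth u v" "sorted r"
  shows "snd (row_inserts u r) = snd (row_inserts v r) \<and>
    (fst (row_inserts u r) = fst (row_inserts v r) \<or>
     knuth (fst (row_inserts u r)) (fst (row_inserts v r)) \<or>
     knuth (fst (row_inserts v r)) (fst (row_inserts u r)))"
proof -
  have *: "\<exists>r0 r1 r2 r3. r = r0 @ r1 @ r2 @ r3 \<and> (\<forall>a\<in>set r0. a \<le> x) \<and>
      (\<forall>a\<in>set r1. x < a \<and> a \<le> y) \<and> (\<forall>a\<in>set r2. y < a \<and> a \<le> z) \<and> (\<forall>a\<in>set r3. z < a) \<and>
      sorted r1 \<and> sorted r2 \<and> sorted r3" if "x \<le> y" "y \<le> z" for x y z
  proof -
    obtain r0 s0 where 0: "r = r0 @ s0" "\<forall>a\<in>set r0. a \<le> x" "\<forall>a\<in>set s0. x < a" "sorted s0"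
      using assms(2) by (rule sorted_split)
    obtain r1 s1 where 1: "s0 = r1 @ s1" "\<forall>a\<in>set r1. a \<le> y" "\<forall>a\<in>set s1. y < a" "sorted s1"
      using 0(4) by (rule sorted_split)
    obtain r2 r3 where 2: "s1 = r2 @ r3" "\<forall>a\<in>set r2. a \<le> z" "\<forall>a\<in>set r3. z < a" "sorted r3"
      using 1(4) by (rule sorted_split)
    show ?thesis
      by (rule exI[of _ r0], rule exI[of _ r1], rule exI[of _ r2], rule exI[of _ r3])
        (use 0 1 2 in \<open>auto simp: sorted_append\<close>)
  qed
  show ?thesis
    using assms(1)
  proof cases
    case (knuth1 x y z)
    obtain r0 r1 r2 r3 where r: "r = r0 @ r1 @ r2 @ r3" "\<forall>a\<in>set r0. a \<le> x"
      "\<forall>a\<in>set r1. x < a \<and> a \<le> y" "\<forall>a\<in>set r2. y < a \<and> a \<le> z" "\<forall>a\<in>set r3. z < a"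
      "sorted r1" "sorted r2" "sorted r3"
      using *[of x y z] knuth1 by auto
    have "\<forall>a\<in>set r0. a \<le> y" "\<forall>a\<in>set r0. a \<le> z" "\<forall>a\<in>set r1. a \<le> z"
      using r knuth1 by force+
    with r(2-) knuth1(3,4) show ?thesis
      unfolding knuth1(1,2) r(1)
      by (cases r1; cases r2; cases r3; cases "tl r3")
        (simp_all add: row_insert_append row_insert_greatest knuth_triple)
  next
    case (knuth2 x y z)
    obtain r0 r1 r2 r3 where r: "r = r0 @ r1 @ r2 @ r3" "\<forall>a\<in>set r0. a \<le> x"
      "\<forall>a\<in>set r1. x < a \<and> a \<le> y" "\<forall>a\<in>set r2. y < a \<and> a \<le> z" "\<forall>a\<in>set r3. z < a"
      "sorted r1" "sorted r2" "sorted r3"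
      using *[of x y z] knuth2 by auto
    have "\<forall>a\<in>set r0. a \<le> y" "\<forall>a\<in>set r0. a \<le> z" "\<forall>a\<in>set r1. a \<le> z"
      using r knuth2 by force+
    with r(2-) knuth2(3,4) show ?thesis
      unfolding knuth2(1,2) r(1)
      by (cases r1; cases r2; cases r3; cases "tl r2"; cases "tl r3")
        (simp_all add: row_insert_append row_insert_greatest knuth_triple)
  qed
qed

text \<open>The first rows agree and the words handed down are equal or again Knuth related, so the
  relation descends until no row is left, where both triples build the same tableau.\<close>

lemma fold_tableau_insert_knuth:
  "knuth u v \<Longrightarrow> \<forall>r\<in>set T. sorted r \<Longrightarrow> fold tableau_insert u T = fold tableau_insert v T"
proof (induction T arbitrary: u v)
  case Nil
  then show ?case by (auto elim!: knuth.cases)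
next
  case (Cons r T)
  then show ?case using row_inserts_knuth[of u v r]
    unfolding fold_tableau_insert_Cons by fastforce
qed

lemma P_tableau_knuth:
  assumes "knuth u v"
  shows "P_tableau (s @ u @ t) = P_tableau (s @ v @ t)"
  unfolding P_tableau_def
  using fold_tableau_insert_knuth[OF assms, of "fold tableau_insert s []"]
    sorted_fold_tableau_insert[of "[]" s] by simp

section \<open>Row bumping as a chain of Knuth moves\<close>

lemma P_tableau_move_left:
  "sorted (y # B) \<Longrightarrow> x < y \<Longrightarrow> P_tableau (s @ y # B @ x # t) = P_tableau (s @ y # x # B @ t)"
proof (induction B arbitrary: s y)
  case (Cons b B)
  have "P_tableau (s @ y # (b # B) @ x # t) = P_tableau (s @ y # b # x # B @ t)"
    using Cons.IH[of b "s @ [y]"] Cons.prems by simp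
  also have "\<dots> = P_tableau (s @ y # x # (b # B) @ t)"
    using P_tableau_knuth[OF knuth1[of x y b], of s "B @ t"] Cons.prems by simp
  finally show ?case .
qed simp

lemma P_tableau_bumped_left:
  "sorted (A @ [x]) \<Longrightarrow> x < y \<Longrightarrow> P_tableau (s @ A @ y # x # t) = P_tableau (s @ y # A @ x # t)"
proof (induction A arbitrary: s)
  case (Cons a A)
  \<comment> \<open>Once \<open>y\<close> has passed \<open>A\<close>, \<open>h\<close> is the
    letter right after \<open>y\<close>. It is the middle value of the Knuth move, and it is
    \<open>x\<close> itself when \<open>A\<close> is empty.\<close>
  obtain h B where h: "A @ x # t = h # B" "h \<in> insert x (set A)" by (cases A) auto
  then have "a \<le> h" "h < y" using Cons.prems by (fastforce simp: sorted_append)+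
  have "P_tableau (s @ (a # A) @ y # x # t) = P_tableau (s @ a # y # A @ x # t)"
    using Cons.IH[of "s @ [a]"] Cons.prems by simp
  also have "\<dots> = P_tableau (s @ y # a # A @ x # t)"
    using P_tableau_knuth[OF knuth2[of a h y], of s B] \<open>a \<le> h\<close> \<open>h < y\<close> by (simp add: h)
  finally show ?case by simp
qed simp

text \<open>The relation \<open>r x = y r'\<close> of the plactic monoid: \<open>x\<close> moves
  left over the entries behind \<open>y\<close>, then \<open>y\<close> moves left over the entries
  in front of it.\<close>

lemma P_tableau_row_insert:
  assumes "sorted r" "row_insert x r = (Some y, r')"
  shows "P_tableau (s @ r @ x # t) = P_tableau (s @ y # r' @ t)"
proof -
  obtain A B where r: "r = A @ y # B" "r' = A @ x # B" "\<forall>a\<in>set A. a \<le> x" "x < y"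
    using assms(2) by (rule row_insert_SomeE)
  have "P_tableau (s @ r @ x # t) = P_tableau (s @ A @ y # x # B @ t)"
    using P_tableau_move_left[of y B x "s @ A" t] assms(1) r by (simp add: sorted_append)
  also have "\<dots> = P_tableau (s @ y # r' @ t)"
    using P_tableau_bumped_left[of A x y s "B @ t"] assms(1) r by (simp add: sorted_append)
  finally show ?thesis .
qed


section \<open>Semistandard tableaux\<close>

definition column_strict :: "nat list \<Rightarrow> nat list \<Rightarrow> bool" where
  "column_strict s u \<longleftrightarrow> length u \<le> length s \<and> (\<forall>j<length u. s ! j < u ! j)"

text \<open>Unlike \<open>standard_tableau\<close>, this passes to the tableau of the lower rows,
  whose entries need not form an initial interval; the inductions on rows rely on that.\<close>

definition semistandard :: "tableau \<Rightarrow> bool" where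
  "semistandard T \<longleftrightarrow> [] \<notin> set T \<and> (\<forall>r\<in>set T. sorted r) \<and> successively column_strict T"

lemma column_strict_Nil [simp]: "column_strict s []"
  by (simp add: column_strict_def)

lemma column_strict_Cons [simp]:
  "column_strict (x # s) (y # u) \<longleftrightarrow> x < y \<and> column_strict s u"
  by (auto simp: column_strict_def less_Suc_eq_0_disj)

lemma column_strict_Nil_left [simp]: "column_strict [] u \<longleftrightarrow> u = []"
  by (auto simp: column_strict_def)

text \<open>The entry \<open>y\<close> leaves column \<open>length p\<close> of \<open>s\<close>.
  What stands below it in \<open>u\<close> exceeds \<open>y\<close>, so \<open>y\<close> lands
  weakly to the left (\<open>small\<close>), where the entry above is now \<open>x\<close> or an
  entry of \<open>p\<close>, both less than \<open>y\<close>.\<close>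

lemma column_strict_bump:
  assumes "column_strict s u" "row_insert x s = (Some y, s')" "row_insert y u = (b, u')"
  shows "column_strict s' u'"
proof -
  obtain p q where s: "s = p @ y # q" "s' = p @ x # q" "\<forall>a\<in>set p. a \<le> x" "x < y"
    using assms(2) by (rule row_insert_SomeE)
  have small: "length v \<le> length p" if "u = v @ v'" "\<forall>a\<in>set v. a \<le> y" for v v'
  proof (rule ccontr)
    assume "\<not> length v \<le> length p"
    then have "u ! length p \<le> y" using that by (auto simp: nth_append)
    moreover have "y < u ! length p"
      using assms(1) \<open>\<not> length v \<le> length p\<close> that s(1)
      by (auto simp: column_strict_def nth_append dest!: spec[of _ "length p"])
    ultimately show False by simp
  qed
  have p: "p ! j < y" if "j < length p" for j
    using s that by (meson le_less_trans nth_mem)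
  show ?thesis
  proof (cases b)
    case None
    then have u: "\<forall>a\<in>set u. a \<le> y" "u' = u @ [y]" using row_insert_NoneD assms(3) by blast+
    show ?thesis
      using small[of u "[]"] u s assms(1) p
      by (auto simp: column_strict_def nth_append nth_Cons' less_Suc_eq)
  next
    case (Some z)
    then obtain p' q' where u: "u = p' @ z # q'" "u' = p' @ y # q'" "\<forall>a\<in>set p'. a \<le> y" "y < z"
      using assms(3) row_insert_SomeE by metis
    have "u' ! j > s' ! j" if j: "j < length u'" for j
    proof -
      have "s ! j < u ! j" using assms(1) j u by (auto simp: column_strict_def)
      then show ?thesis
        using small[of p' "z # q'"] u s p[of j] by (auto simp: nth_append nth_Cons' split: if_splits)
    qed
    then show ?thesis
      using assms(1) s u by (auto simp: column_strict_def)
  qed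
qed

lemma column_strict_append: "column_strict s u \<Longrightarrow> column_strict (s @ v) u"
  by (auto simp: column_strict_def nth_append)

lemma semistandard_tableau_insert: "semistandard T \<Longrightarrow> semistandard (tableau_insert x T)"
proof -
  have "successively column_strict (tableau_insert x T)" if "successively column_strict T" for T x
    using that
  proof (induction T arbitrary: x)
    case (Cons s T)
    obtain b s' where b: "row_insert x s = (b, s')" by fastforce
    show ?case
    proof (cases b)
      case None
      then show ?thesis
        using Cons.prems b row_insert_NoneD[of x s s']
        by (auto simp: successively_Cons column_strict_append)
    next
      case (Some y)
      have *: "successively column_strict (tableau_insert y T)"
        using Cons by (auto simp: successively_Cons)
      show ?thesis
      proof (cases T)
        case Nil
        \<comment> \<open>The new bottom row is treated as the result of inserting \<open>y\<close>
          into an empty row.\<close>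
        have "column_strict s' [y]"
          using column_strict_bump[of s "[]" x y s' None "[y]"] b Some by simp
        then show ?thesis using Nil b Some by simp
      next
        case (Cons u U)
        obtain d u' where d: "row_insert y u = (d, u')" by fastforce
        then have "hd (tableau_insert y T) = u'"
          using Cons by (auto split: option.splits)
        moreover have "column_strict s' u'"
          using column_strict_bump[OF _ _ d] b Some \<open>successively column_strict (s # T)\<close> Cons by auto
        ultimately show ?thesis using * b Some by (auto simp: successively_Cons)
      qed
    qed
  qed simp
  moreover have "[] \<notin> set (tableau_insert x T)" if "[] \<notin> set T" for T x
    using that
  proof (induction T arbitrary: x)
    case (Cons s T)
    obtain b s' where b: "row_insert x s = (b, s')" by fastforce
    have "s' \<noteq> []"
      using b by (cases b) (auto dest: row_insert_NoneD elim: row_insert_SomeE)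
    with b Cons show ?case by (auto split: option.splits)
  qed simp
  ultimately show "semistandard T \<Longrightarrow> semistandard (tableau_insert x T)"
    using sorted_tableau_insert[of T x] by (simp add: semistandard_def)
qed

lemma semistandard_P_tableau: "semistandard (P_tableau w)"
proof -
  have "semistandard (fold tableau_insert w T)" if "semistandard T" for T
    using that by (induction w arbitrary: T) (auto simp: semistandard_tableau_insert)
  moreover have "semistandard []" by (simp add: semistandard_def)
  ultimately show ?thesis by (simp add: P_tableau_def)
qed


section \<open>Insertion of increasing words\<close>

text \<open>\<open>p\<close> collects the letters already inserted. Since \<open>a\<close> is
  sorted, the next letter passes over \<open>p\<close> and bumps the first remaining entry of
  \<open>s\<close>.\<close>

lemma row_inserts_column_strict:
  "sorted a \<Longrightarrow> \<forall>c\<in>set p. \<forall>d\<in>set a. c \<le> d \<Longrightarrow> column_strict a s \<Longrightarrow>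
     row_inserts a (p @ s) = (s, p @ a)"
proof (induction a arbitrary: p s)
  case (Cons x a)
  then show ?case
    \<comment> \<open>\<open>tl s\<close> serves both cases: a nonempty \<open>s\<close> loses its
      bumped head, an empty one stays empty while \<open>x\<close> is appended.\<close>
    using Cons.IH[of "p @ [x]" "tl s"] by (cases s) (auto simp: row_insert_append row_insert_greatest)
qed simp

lemma fold_tableau_insert_row:
  "semistandard (r # T) \<Longrightarrow> fold tableau_insert r T = r # T"
proof (induction T arbitrary: r)
  case Nil
  then show ?case
    using row_inserts_column_strict[of r "[]" "[]"]
    by (subst fold_tableau_insert_Nil) (auto simp: semistandard_def fold_tableau_insert_Cons)
next
  case (Cons s T)
  then have "row_inserts r s = (s, r)" "semistandard (s # T)"
    using row_inserts_column_strict[of r "[]" s] by (auto simp: semistandard_def)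
  then show ?case using Cons.IH[of s] by (simp add: fold_tableau_insert_Cons)
qed

text \<open>Rows enter from the bottom up, and each one pushes the tableau built so far down by one
  row.\<close>

lemma P_tableau_reading_word:
  "semistandard T \<Longrightarrow> P_tableau (concat (rev T)) = T"
proof (induction T)
  case (Cons r T)
  then have "semistandard T" by (auto simp: semistandard_def successively_Cons)
  with Cons have "P_tableau (concat (rev T)) = T" by simp
  then show ?case using fold_tableau_insert_row[OF Cons.prems] by (simp add: P_tableau_def)
qed (simp add: P_tableau_def)

text \<open>The word that an increasing word \<open>a\<close> bumps out of a row \<open>s\<close>.
  Successive insertion points move to the right, so inserted letters are never bumped again and one
  greedy pass over \<open>s\<close> suffices.\<close>

fun bumped :: "nat list \<Rightarrow> nat list \<Rightarrow> nat list" where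
  "bumped [] s = []"
| "bumped (x # a) [] = []"
| "bumped (x # a) (y # s) = (if x < y then y # bumped a s else bumped (x # a) s)"

lemma fst_row_inserts:
  "sorted a \<Longrightarrow> \<forall>c\<in>set p. \<forall>d\<in>set a. c \<le> d \<Longrightarrow> fst (row_inserts a (p @ s)) = bumped a s"
proof (induction a s arbitrary: p rule: bumped.induct)
  case (2 x a)
  have "fst (row_inserts a (q @ [])) = []" if "\<forall>c\<in>set q. \<forall>d\<in>set a. c \<le> d" "sorted a" for q
    using that
  proof (induction a arbitrary: q)
    case (Cons y a)
    then show ?case using Cons.IH[of "q @ [y]"] row_insert_append[of q y "[]"]
      by (auto split: prod.splits)
  qed simp
  from this[of "p @ [x]"] 2 show ?case
    using row_insert_append[of p x "[]"] by (auto split: prod.splits)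
next
  case (3 x a y s)
  show ?case
  proof (cases "x < y")
    case True
    then show ?thesis using 3(1)[of "p @ [x]"] 3(3,4)
      by (auto simp: row_insert_append split: prod.splits)
  next
    case False
    then show ?thesis using 3(2)[of "p @ [y]"] 3(3,4) by fastforce
  qed
qed simp

lemma set_bumped: "set (bumped a s) \<subseteq> set s"
  by (induction a s rule: bumped.induct) auto

lemma sorted_bumped: "sorted s \<Longrightarrow> sorted (bumped a s)"
  by (induction a s rule: bumped.induct) (auto dest!: set_bumped[THEN subsetD])

text \<open>Each entry of \<open>s\<close> that is skipped is missing from the bumped word. If none
  is skipped, the \<open>j\<close>-th letter of \<open>a\<close> bumps the \<open>j\<close>-th entry
  of \<open>s\<close> and is less than it.\<close>

lemma length_bumped:
  "length (bumped a s) \<le> length s" "length (bumped a s) = length s \<Longrightarrow> column_strict a s"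
proof -
  show le: "length (bumped a s) \<le> length s" for a s
    by (induction a s rule: bumped.induct) auto
  show "length (bumped a s) = length s \<Longrightarrow> column_strict a s"
  proof (induction a s rule: bumped.induct)
    case (3 x a y s)
    then show ?case using le[of "x # a" s] by (auto split: if_splits)
  qed auto
qed

text \<open>One step of the column scan below: \<open>q\<close> is the part of the row that may have
  changed, \<open>u\<close> the part still untouched.\<close>

lemma row_insert_hd:
  assumes "u = [] \<or> x < hd u" "length q \<le> m"
  shows "\<exists>q'. snd (row_insert x (q @ u)) = q' @ tl u \<and> length q' \<le> Suc m"
proof (cases "\<forall>a\<in>set q. a \<le> x")
  case True
  then show ?thesis using assms
    by (cases u) (auto simp: row_insert_append row_insert_greatest intro!: exI[of _ "q @ [x]"])
next
  case False
  then obtain v z v' where q: "q = v @ z # v'" "x < z" "\<forall>a\<in>set v. a \<le> x"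
    using split_list_first_prop[of q "\<lambda>a. x < a"] by (metis not_less)
  \<comment> \<open>Although the insertion falls inside \<open>q\<close>, the first entry of
    \<open>u\<close> is handed over as well, so that \<open>tl u\<close> is what remains in every
    case.\<close>
  have "length (v @ x # v' @ take 1 u) \<le> Suc m"
    using assms(2) q by auto
  moreover have "snd (row_insert x (q @ u)) = (v @ x # v' @ take 1 u) @ tl u"
    using q by (cases u) (auto simp: row_insert_append)
  ultimately show ?thesis by blast
qed

text \<open>An entry bumped out of column \<open>m\<close> of the row \<open>s\<close> lands weakly to the left of column \<open>m\<close> of
  the row \<open>u\<close> below, so that row never becomes longer than \<open>s\<close> was.\<close>

lemma length_row_inserts_bumped:
  "column_strict s u \<Longrightarrow> length q \<le> m \<Longrightarrow>
     length (snd (row_inserts (bumped a s) (q @ u))) \<le> m + length s"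
proof (induction a s arbitrary: q u m rule: bumped.induct)
  case (3 x a y s)
  have tl: "column_strict s (tl u)" using 3(3) by (cases u) auto
  show ?case
  proof (cases "x < y")
    case True
    have "u = [] \<or> y < hd u" using 3(3) by (cases u) auto
    then obtain q' where q': "snd (row_insert y (q @ u)) = q' @ tl u" "length q' \<le> Suc m"
      using row_insert_hd 3(4) by blast
    then show ?thesis using 3(1)[OF True tl q'(2)] True
      by (auto split: prod.splits)
  next
    case False
    \<comment> \<open>The entry \<open>y\<close> of \<open>s\<close> is skipped, but the scan still
      advances one column.\<close>
    have "length (q @ take 1 u) \<le> Suc m" using 3(4) by simp
    from 3(2)[OF False tl this] False show ?thesis by (cases u) auto
  qed
qed (auto simp: column_strict_def)

text \<open>The boxes added by an increasing word form a horizontal strip. The word bumped into the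
  next row is again increasing, so the bound for the first two rows propagates downwards.\<close>

lemma shape_interlace:
  assumes "semistandard T" "sorted a" "Suc i < length (fold tableau_insert a T)"
  shows "i < length T \<and> length (fold tableau_insert a T ! Suc i) \<le> length (T ! i)"
  using assms
proof (induction T arbitrary: a i)
  case Nil
  have "a \<noteq> []" using Nil by auto
  moreover have "fst (row_inserts a []) = []"
    using fst_row_inserts[of a "[]" "[]"] Nil(2) by (cases a) auto
  ultimately show ?case
    using Nil by (simp add: fold_tableau_insert_Nil fold_tableau_insert_Cons)
next
  case (Cons s T)
  let ?b = "bumped a s"
  have b: "fst (row_inserts a s) = ?b" using fst_row_inserts[of a "[]" s] Cons.prems by simp
  have T: "semistandard T" "sorted ?b"
    using Cons.prems by (auto simp: semistandard_def successively_Cons sorted_bumped)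
  show ?case
  proof (cases i)
    case (Suc j)
    then show ?thesis
      using Cons.IH[OF T, of j] Cons.prems by (simp add: fold_tableau_insert_Cons b)
  next
    case 0
    have "length (fold tableau_insert ?b T ! 0) \<le> length s"
    proof (cases T)
      case Nil
      then have "?b \<noteq> []" using Cons.prems 0 by (auto simp: fold_tableau_insert_Cons b)
      with Nil show ?thesis
        using length_row_inserts_bumped[of s "[]" "[]" 0 a]
        by (simp add: fold_tableau_insert_Nil fold_tableau_insert_Cons)
    next
      case (Cons u U)
      then show ?thesis
        using length_row_inserts_bumped[of s u "[]" 0 a] \<open>semistandard (s # T)\<close>
        by (simp add: fold_tableau_insert_Cons semistandard_def)
    qed
    then show ?thesis using 0 by (simp add: fold_tableau_insert_Cons b)
  qed
qed

text \<open>Turns rowwise inequalities between two shapes of equal size into equality; positive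
  parts in \<open>ys\<close> exclude surplus rows.\<close>

lemma sum_list_dominated:
  assumes "length xs \<le> length ys" "\<forall>i<length xs. xs ! i \<le> ys ! i" "0 \<notin> set (ys :: nat list)"
  shows "sum_list xs \<le> sum_list ys \<and> (sum_list xs = sum_list ys \<longrightarrow> xs = ys)"
  using assms
proof (induction xs arbitrary: ys)
  case Nil
  then show ?case by (cases ys) auto
next
  case (Cons x xs)
  then obtain y zs where ys: "ys = y # zs" by (cases ys) auto
  have "\<forall>i<length xs. xs ! i \<le> zs ! i"
    using Cons.prems(2) ys by (metis Suc_less_eq length_Cons nth_Cons_Suc)
  then show ?case using Cons.IH[of zs] Cons.prems ys
    by (fastforce dest: spec[of _ 0])
qed

lemma length_concat_shape: "length (concat T) = sum_list (shape T)"
  by (simp add: length_concat shape_def)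

lemma semistandard_if_shape_P_tableau:
  assumes "[] \<notin> set T" "\<forall>r\<in>set T. sorted r" "shape (P_tableau (concat (rev T))) = shape T"
  shows "semistandard T"
  using assms
proof (induction T)
  case Nil
  then show ?case by (simp add: semistandard_def)
next
  case (Cons r T)
  let ?U = "P_tableau (concat (rev T))"
  have P: "P_tableau (concat (rev (r # T))) = fold tableau_insert r ?U"
    by (simp add: P_tableau_def)
  have U: "semistandard ?U" by (rule semistandard_P_tableau)
  have len: "length (fold tableau_insert r ?U) = Suc (length T)"
    and nth: "\<And>i. i < Suc (length T) \<Longrightarrow>
        length (fold tableau_insert r ?U ! i) = length ((r # T) ! i)"
  proof -
    have "map length (fold tableau_insert r ?U) = map length (r # T)"
      using Cons.prems(3) P by (simp add: shape_def)
    then show "length (fold tableau_insert r ?U) = Suc (length T)"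
      "\<And>i. i < Suc (length T) \<Longrightarrow> length (fold tableau_insert r ?U ! i) = length ((r # T) ! i)"
      by (metis length_Cons length_map, metis length_Cons length_map nth_map)
  qed
  \<comment> \<open>Row \<open>Suc i\<close> of the final tableau has the length of
    \<open>T ! i\<close> by the shape assumption; interlacing bounds it by row \<open>i\<close>
    before \<open>r\<close> is inserted.\<close>
  have inter: "i < length ?U \<and> length (T ! i) \<le> length (?U ! i)" if "i < length T" for i
    using shape_interlace[OF U, of r i] len nth[of "Suc i"] that Cons.prems(2) by simp
  then have "length T \<le> length ?U" by (meson not_less less_irrefl)
  moreover have "length (concat ?U) = length (concat T)"
    using mset_concat_P_tableau[of "concat (rev T)"]
    by (metis length_concat_rev mset_eq_length)
  moreover have "0 \<notin> set (shape ?U)" using U by (auto simp: semistandard_def shape_def)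
  ultimately have "shape ?U = shape T"
    using sum_list_dominated[of "shape T" "shape ?U"] inter
    by (auto simp: length_concat_shape) (auto simp: shape_def)
  then have T: "semistandard T" using Cons by simp
  then have UT: "?U = T" by (rule P_tableau_reading_word)
  show ?case
  proof (cases T)
    case Nil
    then show ?thesis using Cons.prems by (simp add: semistandard_def)
  next
    case (Cons s V)
    \<comment> \<open>The first row ends with as many entries as \<open>r\<close>, so by
      conservation of entries exactly \<open>length s\<close> of them were bumped: all of
      \<open>s\<close>.\<close>
    have "length (snd (row_inserts r s)) = length r"
      using nth[of 0] UT Cons by (simp add: fold_tableau_insert_Cons)
    then have "length (fst (row_inserts r s)) = length s"
      using length_row_inserts[of r s] by simp
    then have "column_strict r s"
      using fst_row_inserts[of r "[]" s] \<open>\<forall>r\<in>set (r # T). sorted r\<close> by (simp add: length_bumped)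
    then show ?thesis
      using T Cons \<open>\<forall>r\<in>set (r # T). sorted r\<close> \<open>[] \<notin> set (r # T)\<close>
      by (auto simp: semistandard_def)
  qed
qed


section \<open>The carrier\<close>

text \<open>A window of boxes is used because the word is cut at the carrier, with moved balls on
  its left and unmoved ones on its right.\<close>

definition ball_word :: "config \<Rightarrow> nat \<Rightarrow> nat \<Rightarrow> nat list" where
  "ball_word c a b = map (\<lambda>i. the (c i)) (filter (\<lambda>i. c i \<noteq> None) [a..<b])"

lemma ball_word_append:
  "a \<le> m \<Longrightarrow> m \<le> b \<Longrightarrow> ball_word c a b = ball_word c a m @ ball_word c m b"
  unfolding ball_word_def by (metis filter_append map_append upt_add_eq_append le_add_diff_inverse)

lemma ball_word_Suc:
  "a \<le> b \<Longrightarrow> ball_word c a (Suc b) = ball_word c a b @ (case c b of None \<Rightarrow> [] | Some k \<Rightarrow> [k])"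
  by (auto simp: ball_word_def split: option.splits)

lemma ball_word_head:
  "a < b \<Longrightarrow> ball_word c a b = (case c a of None \<Rightarrow> [] | Some k \<Rightarrow> [k]) @ ball_word c (Suc a) b"
  by (auto simp: ball_word_def upt_conv_Cons split: option.splits)

lemma ball_word_empty: "\<forall>i\<in>{a..<b}. c i = None \<Longrightarrow> ball_word c a b = []"
  by (auto simp: ball_word_def filter_empty_conv)

lemma ball_word_full: "\<forall>i\<in>{a..<b}. c i \<noteq> None \<Longrightarrow> ball_word c a b = block_labels c a b"
  unfolding ball_word_def block_labels_def by (subst filter_True) auto

text \<open>Positions as a function of the label: moving a ball is an update of \<open>p\<close>,
  and the equivalence also says that each of the balls \<open>{1..n}\<close> occurs once and no
  others do.\<close>

definition represents :: "nat \<Rightarrow> config \<Rightarrow> (nat \<Rightarrow> nat) \<Rightarrow> bool" where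
  "represents n c p \<longleftrightarrow> (\<forall>i k. c i = Some k \<longleftrightarrow> k \<in> {1..n} \<and> p k = i)"

lemma represents_None: "represents n c p \<Longrightarrow> c i = None \<longleftrightarrow> i \<notin> p ` {1..n}"
  unfolding represents_def by (metis imageE imageI not_None_eq)

lemma represents_inj: "represents n c p \<Longrightarrow> inj_on p {1..n}"
  unfolding represents_def inj_on_def by (metis option.inject)

lemma represents_bound:
  assumes "represents n c p"
  shows "\<exists>M. \<forall>i\<ge>M. c i = None"
proof -
  have "finite (p ` {1..n})" by simp
  then obtain M where "\<forall>x\<in>p ` {1..n}. x < M"
    unfolding finite_nat_set_iff_bounded by auto
  then show ?thesis by (meson represents_None[OF assms] not_less)
qed

section \<open>Positions after moving one ball and after a full move\<close>

lemma move_ball_represents: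
  assumes "represents n c p" "k \<in> {1..n}"
  shows "\<exists>q. p k < q \<and> q \<notin> p ` {1..n} \<and> (\<forall>i. p k < i \<and> i < q \<longrightarrow> i \<in> p ` {1..n}) \<and>
    represents n (move_ball k c) (p(k := q))"
proof -
  have pos: "ball_position c k = p k"
    using assms unfolding ball_position_def represents_def by auto
  define Q where "Q q \<longleftrightarrow> p k < q \<and> c q = None" for q
  obtain M where "\<forall>i\<ge>M. c i = None" using represents_bound[OF assms(1)] by blast
  \<comment> \<open>A box beyond all balls and to the right of ball \<open>k\<close> shows that the
    \<open>LEAST\<close> is attained.\<close>
  then have "Q (max M (Suc (p k)))" by (simp add: Q_def)
  then have Q: "Q (LEAST q. Q q)" by (rule LeastI)
  define q where "q = (LEAST q. Q q)"
  have less: "c i \<noteq> None" if "p k < i" "i < q" for i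
    using not_less_Least[of i Q] that by (simp add: q_def) (simp add: Q_def)
  have q: "p k < q" "c q = None" using Q by (auto simp: q_def Q_def)
  have "move_ball k c = c(p k := None, q := Some k)"
    unfolding move_ball_def Let_def pos q_def Q_def by simp
  moreover have "p j \<noteq> q" "p j = p k \<Longrightarrow> j = k" if "j \<in> {1..n}" for j
    using q represents_None[OF assms(1), of q] inj_onD[OF represents_inj[OF assms(1)]] assms(2) that
    by auto
  ultimately have "represents n (move_ball k c) (p(k := q))"
    using assms q unfolding represents_def by auto
  then show ?thesis
    using q less represents_None[OF assms(1)] by blast
qed

text \<open>When ball \<open>k\<close> moves, smaller balls are at their new positions
  \<open>q\<close> and larger ones at their old positions \<open>p\<close>. This describes the move
  by \<open>p\<close> and \<open>q\<close> alone, without intermediate configurations.\<close>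

lemma fold_move_ball_represents:
  assumes "represents n c p" "m \<le> n"
  shows "\<exists>q. represents n (fold move_ball [1..<Suc m] c) q \<and> (\<forall>j>m. q j = p j) \<and>
    (\<forall>k\<in>{1..m}. p k < q k \<and> (\<forall>j\<in>{k<..n}. p j \<noteq> q k) \<and>
      (\<forall>i. p k < i \<and> i < q k \<longrightarrow> (\<exists>j\<in>{k<..n}. p j = i) \<or> (\<exists>j\<in>{1..<k}. q j = i)))"
  using assms(2)
proof (induction m)
  case 0
  then show ?case using assms(1) by (intro exI[of _ p]) simp
next
  case (Suc m)
  let ?k = "Suc m"
  from Suc obtain q where q: "represents n (fold move_ball [1..<Suc m] c) q"
    "\<forall>j>m. q j = p j"
    "\<forall>k\<in>{1..m}. p k < q k \<and> (\<forall>j\<in>{k<..n}. p j \<noteq> q k) \<and>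
      (\<forall>i. p k < i \<and> i < q k \<longrightarrow> (\<exists>j\<in>{k<..n}. p j = i) \<or> (\<exists>j\<in>{1..<k}. q j = i))"
    by auto
  obtain t where t: "q ?k < t" "t \<notin> q ` {1..n}"
    "\<forall>i. q ?k < i \<and> i < t \<longrightarrow> i \<in> q ` {1..n}"
    "represents n (move_ball ?k (fold move_ball [1..<Suc m] c)) (q(?k := t))"
    using move_ball_represents[OF q(1), of ?k] Suc.prems by auto
  have new: "(\<exists>j\<in>{?k<..n}. p j = i) \<or> (\<exists>j\<in>{1..<?k}. q j = i)" if i: "p ?k < i" "i < t" for i
  proof -
    obtain j where j: "j \<in> {1..n}" "q j = i" using t(3) i q(2) by auto
    moreover have "j \<noteq> ?k" using j i q(2) by auto
    ultimately show ?thesis using q(2) by (cases "j < ?k") auto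
  qed
  have other: "p j \<noteq> t" if "j \<in> {?k<..n}" for j
    using t(2) q(2) that by (metis Suc_lessD greaterThanAtMost_iff atLeastAtMost_iff image_eqI
        not_less_zero One_nat_def Suc_leI gr0I)
  show ?case
  proof (intro exI[of _ "q(?k := t)"] conjI ballI)
    show "represents n (fold move_ball [1..<Suc ?k] c) (q(?k := t))" using t(4) by simp
    show "\<forall>j>?k. (q(?k := t)) j = p j" using q(2) by auto
    fix k assume k: "k \<in> {1..?k}"
    show "p k < (q(?k := t)) k" using k q t by (cases "k = ?k") auto
    show "p j \<noteq> (q(?k := t)) k" if "j \<in> {k<..n}" for j
      using k q(3) other that by (cases "k = ?k") auto
    show "\<forall>i. p k < i \<and> i < (q(?k := t)) k \<longrightarrow>
        (\<exists>j\<in>{k<..n}. p j = i) \<or> (\<exists>j\<in>{1..<k}. (q(?k := t)) j = i)"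
    proof (cases "k = ?k")
      case True
      then show ?thesis using new by force
    next
      case False
      then have "k \<in> {1..m}" using k by auto
      then show ?thesis using q(3) by fastforce
    qed
  qed
qed

text \<open>The list \<open>L\<close> holds the balls that travel over the left border of box \<open>i\<close> during the move.
  At box \<open>i\<close> an occupying ball is inserted into \<open>L\<close> as into a row of a tableau and the bumped ball,
  if any, takes its place, while an empty box receives the smallest ball of \<open>L\<close>.\<close>

lemma P_tableau_carrier:
  assumes c: "represents n c p" and c': "represents n c' q"
    and pq: "\<And>k. k \<in> {1..n} \<Longrightarrow> p k < q k"
    and free: "\<And>j k. k \<in> {1..n} \<Longrightarrow> j \<in> {k<..n} \<Longrightarrow> p j \<noteq> q k"
    and least: "\<And>k i. k \<in> {1..n} \<Longrightarrow> p k < i \<Longrightarrow> i < q k \<Longrightarrow>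
        (\<exists>j\<in>{k<..n}. p j = i) \<or> (\<exists>j\<in>{1..<k}. q j = i)"
    and "i \<le> N"
  shows "\<exists>L. sorted_wrt (<) L \<and> set L = {k\<in>{1..n}. p k < i \<and> i \<le> q k} \<and>
    P_tableau (ball_word c' 0 i @ L @ ball_word c i N) = P_tableau (ball_word c 0 N)"
  using \<open>i \<le> N\<close>
proof (induction i)
  case 0
  then show ?case by (intro exI[of _ "[]"]) (simp add: ball_word_def)
next
  case (Suc i)
  let ?C = "\<lambda>i. {k\<in>{1..n}. p k < i \<and> i \<le> q k}"
  obtain L where L: "sorted_wrt (<) L" "set L = ?C i"
    "P_tableau (ball_word c' 0 i @ L @ ball_word c i N) = P_tableau (ball_word c 0 N)"
    using Suc by auto
  have sorted: "sorted L" using L(1) by (simp add: strict_sorted_iff)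
  have step: "?C (Suc i) = {k\<in>?C i. q k \<noteq> i} \<union> {k\<in>{1..n}. p k = i}"
    using pq by (auto simp: less_Suc_eq Suc_le_eq)
  have inj: "k = j" if "q k = i" "q j = i" "k \<in> {1..n}" "j \<in> {1..n}" for j k
    using inj_onD[OF represents_inj[OF c']] that by metis
  \<comment> \<open>This reads \<open>least\<close> at box \<open>i\<close>: a carried ball passes
    over the box only if a larger ball started there or a smaller carried ball lands there.\<close>
  have land: "q k = i" if "k \<in> ?C i" "\<forall>j\<in>{k<..n}. p j \<noteq> i" "\<forall>j\<in>?C i. j < k \<longrightarrow> q j \<noteq> i" for k
  proof (rule ccontr)
    assume "q k \<noteq> i"
    then have "\<exists>j\<in>{1..<k}. q j = i" using least[of k i] that by auto
    then obtain j where j: "j \<in> {1..<k}" "q j = i" by blast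
    then have "j \<in> ?C i" using pq[of j] that(1) by auto
    then show False using that(3) j by auto
  qed
  have Some': "c' i = Some k" if "q k = i" "k \<in> {1..n}" for k
    using c' that by (simp add: represents_def)
  have None': "c' i = None" if "\<forall>k\<in>?C i. q k \<noteq> i"
  proof (rule ccontr)
    assume "c' i \<noteq> None"
    then obtain k where "k \<in> {1..n}" "q k = i" using c' by (auto simp: represents_def)
    then show False using that pq[of k] by auto
  qed
  have head: "ball_word c i N = (case c i of None \<Rightarrow> [] | Some k \<Rightarrow> [k]) @ ball_word c (Suc i) N"
    using Suc.prems by (simp add: ball_word_head)
  show ?case
  proof (cases "c i")
    case None
    then have no: "p k \<noteq> i" if "k \<in> {1..n}" for k
      using represents_None[OF c, of i] that by blast
    show ?thesis
    proof (cases L)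
      case Nil
      then have "?C i = {}" using L(2) by simp
      then have "c' i = None" "?C (Suc i) = {}" using None' step no by auto
      then show ?thesis using L(3) Nil head None
        by (intro exI[of _ "[]"]) (simp add: ball_word_Suc)
    next
      case (Cons k L')
      have k: "k \<in> ?C i" using L(2) Cons by auto
      have min: "k < j" if "j \<in> set L'" for j using L(1) Cons that by simp
      have qk: "q k = i"
        by (rule land[OF k]) (use no k min L(2) Cons in \<open>auto, force\<close>)
      have "set L' = ?C i - {k}" using L(1,2) Cons by auto
      also have "\<dots> = ?C (Suc i)" unfolding step using qk inj k no by blast
      finally show ?thesis using L(1,3) Cons Some'[OF qk] k head None
        by (intro exI[of _ L']) (simp add: ball_word_Suc)
    qed
  next
    case (Some x)
    then have x: "x \<in> {1..n}" "p x = i" using c by (auto simp: represents_def)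
    have px: "k = x" if "p k = i" "k \<in> {1..n}" for k
      by (rule inj_onD[OF represents_inj[OF c]]) (use that x in simp_all)
    then have "{k\<in>{1..n}. p k = i} = {x}" using x by blast
    then have step': "?C (Suc i) = {k\<in>?C i. q k \<noteq> i} \<union> {x}" unfolding step by simp
    \<comment> \<open>A ball smaller than \<open>x\<close> moves while \<open>x\<close> still
      occupies box \<open>i\<close>, so only a larger ball can land there.\<close>
    have above: "x < k" if "q k = i" "k \<in> {1..n}" for k
    proof -
      have "k \<noteq> x" using pq[of k] x that by auto
      moreover have "\<not> k < x" using free[of k x] x that by auto
      ultimately show ?thesis by linarith
    qed
    have xL: "x \<notin> set L" using L(2) x by auto
    obtain b L' where b: "row_insert x L = (b, L')" by fastforce
    show ?thesis
    proof (cases b)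
      case None
      then have L': "\<forall>a\<in>set L. a \<le> x" "L' = L @ [x]" using row_insert_NoneD b by auto
      then have ne: "\<forall>k\<in>?C i. q k \<noteq> i" using above L(2) by fastforce
      then have "c' i = None" using None' by blast
      moreover have "sorted_wrt (<) (L @ [x])"
        using L(1) L' xL by (auto simp: sorted_wrt_append order.strict_iff_order)
      moreover have "set (L @ [x]) = ?C (Suc i)" using step' ne L(2) by auto
      ultimately show ?thesis using L(3) head Some
        by (intro exI[of _ "L @ [x]"]) (simp add: ball_word_Suc)
    next
      case (Some y)
      then obtain A B where AB: "L = A @ y # B" "L' = A @ x # B" "\<forall>a\<in>set A. a \<le> x" "x < y"
        using b row_insert_SomeE by metis
      have y: "y \<in> ?C i" using L(2) AB by auto
      have B: "y < j" if "j \<in> set B" for j using L(1) AB that by (auto simp: sorted_wrt_append)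
      \<comment> \<open>\<open>y\<close> is the smallest carried ball above \<open>x\<close>;
        smaller carried balls are excluded by \<open>above\<close>, and only \<open>x\<close>
        started in this box.\<close>
      have qy: "q y = i"
      proof (rule land[OF y])
        show "\<forall>j\<in>{y<..n}. p j \<noteq> i" using px AB(4) by fastforce
        show "\<forall>j\<in>?C i. j < y \<longrightarrow> q j \<noteq> i"
        proof (intro ballI impI notI)
          fix j assume j: "j \<in> ?C i" "j < y" "q j = i"
          then have "j \<in> set A" using L(2) AB(1) B by fastforce
          then show False using AB(3) above j by fastforce
        qed
      qed
      have "sorted_wrt (<) L'"
        using L(1) AB xL by (auto simp: sorted_wrt_append order.strict_iff_order)
      moreover have "set L' = ?C (Suc i)"
      proof -
        have "set L' = (set L - {y}) \<union> {x}" using L(1) AB by (auto simp: sorted_wrt_append)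
        also have "set L - {y} = {k\<in>?C i. q k \<noteq> i}" using L(2) qy inj y by blast
        finally show ?thesis using step' by simp
      qed
      \<comment> \<open>The carrier \<open>L\<close> followed by \<open>x\<close> becomes the
        dropped ball \<open>y\<close> followed by \<open>L'\<close>, which is a row bump.\<close>
      moreover have "P_tableau (ball_word c' 0 (Suc i) @ L' @ ball_word c (Suc i) N) =
          P_tableau (ball_word c 0 N)"
        using P_tableau_row_insert[OF sorted, of x y L' "ball_word c' 0 i" "ball_word c (Suc i) N"]
          L(3) b Some \<open>c i = Some x\<close> head Some'[OF qy] y by (simp add: ball_word_Suc)
      ultimately show ?thesis by blast
    qed
  qed
qed

lemma P_tableau_bbs_move:
  assumes "represents n c p"
  shows "\<exists>q. represents n (bbs_move n c) q \<and>
    (\<exists>M. \<forall>N\<ge>M. P_tableau (ball_word (bbs_move n c) 0 N) = P_tableau (ball_word c 0 N))"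
proof -
  obtain q where q: "represents n (bbs_move n c) q"
    "\<forall>k\<in>{1..n}. p k < q k \<and> (\<forall>j\<in>{k<..n}. p j \<noteq> q k) \<and>
      (\<forall>i. p k < i \<and> i < q k \<longrightarrow> (\<exists>j\<in>{k<..n}. p j = i) \<or> (\<exists>j\<in>{1..<k}. q j = i))"
    using fold_move_ball_represents[OF assms order_refl] unfolding bbs_move_def by blast
  have "finite (q ` {1..n})" by simp
  then obtain M where M: "\<forall>x\<in>q ` {1..n}. x < M"
    unfolding finite_nat_set_iff_bounded by auto
  have "P_tableau (ball_word (bbs_move n c) 0 N) = P_tableau (ball_word c 0 N)" if "N \<ge> M" for N
  proof -
    obtain L where L: "set L = {k\<in>{1..n}. p k < N \<and> N \<le> q k}"
      "P_tableau (ball_word (bbs_move n c) 0 N @ L @ ball_word c N N) = P_tableau (ball_word c 0 N)"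
      using P_tableau_carrier[OF assms q(1) _ _ _ order_refl, of N] q(2) by blast
    \<comment> \<open>To the right of all final positions the carrier has been emptied.\<close>
    have "q k < N" if "k \<in> {1..n}" for k using M \<open>N \<ge> M\<close> that order.strict_trans2 by blast
    then have "set L = {}" using L(1) by (auto simp: not_le[symmetric])
    then show ?thesis using L(2) by (simp add: ball_word_def)
  qed
  then show ?thesis using q(1) by blast
qed

section \<open>The initial configuration and invariance at all times\<close>

lemma represents_initial_config:
  assumes "w \<in> permutations_of_set {1..n}"
  shows "\<exists>p. represents n (initial_config w) p"
proof -
  have w: "set w = {1..n}" "distinct w" using assms by (auto simp: permutations_of_set_def)
  then have ex1: "\<exists>!i. i < length w \<and> w ! i = k" if "k \<in> {1..n}" for k
    using that by (metis in_set_conv_nth nth_eq_iff_index_eq)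
  have the: "(THE i. i < length w \<and> w ! i = k) = i \<longleftrightarrow> i < length w \<and> w ! i = k"
    if "k \<in> {1..n}" for k i
    using theI'[OF ex1[OF that]] the1_equality[OF ex1[OF that]] by blast
  have "w ! i \<in> {1..n}" if "i < length w" for i using w that nth_mem by blast
  then have "represents n (initial_config w) (\<lambda>k. THE i. i < length w \<and> w ! i = k)"
    unfolding represents_def initial_config_def using the by auto
  then show ?thesis by blast
qed

lemma P_tableau_bbs_state:
  assumes "w \<in> permutations_of_set {1..n}"
  shows "\<exists>p. represents n (bbs_state w t) p \<and>
    (\<exists>M. \<forall>N\<ge>M. P_tableau (ball_word (bbs_state w t) 0 N) = P_tableau w)"
proof (induction t)
  case 0
  have "ball_word (initial_config w) 0 N = w" if "length w \<le> N" for N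
  proof -
    have "ball_word (initial_config w) 0 N =
        ball_word (initial_config w) 0 (length w) @ ball_word (initial_config w) (length w) N"
      using ball_word_append that by blast
    also have "\<dots> = block_labels (initial_config w) 0 (length w)"
      by (simp add: ball_word_empty ball_word_full initial_config_def)
    also have "\<dots> = w"
      by (intro nth_equalityI) (auto simp: block_labels_def initial_config_def)
    finally show ?thesis .
  qed
  then have "\<exists>M. \<forall>N\<ge>M. P_tableau (ball_word (initial_config w) 0 N) = P_tableau w" by metis
  then show ?case using represents_initial_config[OF assms] by (simp add: bbs_state_def)
next
  case (Suc t)
  then obtain p M where p: "represents n (bbs_state w t) p"
    "\<forall>N\<ge>M. P_tableau (ball_word (bbs_state w t) 0 N) = P_tableau w" by blast
  obtain q M' where "represents n (bbs_move n (bbs_state w t)) q"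
    "\<forall>N\<ge>M'. P_tableau (ball_word (bbs_move n (bbs_state w t)) 0 N) =
      P_tableau (ball_word (bbs_state w t) 0 N)"
    using P_tableau_bbs_move[OF p(1)] by blast
  moreover have "bbs_state w (Suc t) = bbs_move n (bbs_state w t)"
    using length_finite_permutations_of_set[OF assms] by (simp add: bbs_state_def)
  ultimately show ?case using p(2)
    by (metis max.bounded_iff)
qed


section \<open>Increasing runs\<close>

lemma increasing_block_iff:
  "increasing_block c a b \<longleftrightarrow> a < b \<and> (\<forall>i\<in>{a..<b}. c i \<noteq> None) \<and>
     (\<forall>i. a \<le> i \<and> Suc i < b \<longrightarrow> the (c i) < the (c (Suc i)))"
proof -
  have "sorted_wrt (<) (block_labels c a b) \<longleftrightarrow>
      (\<forall>i. Suc i < b - a \<longrightarrow> the (c (a + i)) < the (c (Suc (a + i))))"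
    by (subst sorted_wrt_iff_nth_Suc_transp) (auto simp: block_labels_def)
  also have "\<dots> \<longleftrightarrow> (\<forall>i. a \<le> i \<and> Suc i < b \<longrightarrow> the (c i) < the (c (Suc i)))"
  proof safe
    fix i assume *: "\<forall>i. Suc i < b - a \<longrightarrow> the (c (a + i)) < the (c (Suc (a + i)))"
      "a \<le> i" "Suc i < b"
    from *(1)[rule_format, of "i - a"] *(2,3) show "the (c i) < the (c (Suc i))" by simp
  qed auto
  finally show ?thesis unfolding increasing_block_def by blast
qed

text \<open>The two blocks share a box, so each pair of neighbouring boxes in the union lies inside
  one of them; for blocks that merely touch this would fail.\<close>

lemma increasing_block_Un:
  assumes "increasing_block c a b" "increasing_block c a' b'" "a' < b" "a < b'"
  shows "increasing_block c (min a a') (max b b')"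
proof -
  have "the (c i) < the (c (Suc i))" if "min a a' \<le> i" "Suc i < max b b'" for i
  proof -
    have "a \<le> i \<and> Suc i < b \<or> a' \<le> i \<and> Suc i < b'" using that assms(3,4) by linarith
    then show ?thesis using assms(1,2) unfolding increasing_block_iff by blast
  qed
  moreover have "c i \<noteq> None" if "i \<in> {min a a'..<max b b'}" for i
  proof -
    have "i \<in> {a..<b} \<or> i \<in> {a'..<b'}" using that assms(3,4) by auto
    then show ?thesis using assms(1,2) unfolding increasing_block_iff by blast
  qed
  moreover have "min a a' < max b b'" using assms unfolding increasing_block_iff by auto
  ultimately show ?thesis unfolding increasing_block_iff by blast
qed

text \<open>Runs that share a box both equal their union, by maximality.\<close>

lemma increasing_run_unique:
  assumes "increasing_run c a b" "increasing_run c a' b'" "a' < b" "a < b'"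
  shows "a = a' \<and> b = b'"
proof -
  have "increasing_block c (min a a') (max b b')"
    using assms increasing_block_Un by (auto simp: increasing_run_def)
  then have "min a a' = a \<and> max b b' = b" "min a a' = a' \<and> max b b' = b'"
    using assms(1,2) unfolding increasing_run_def by (meson min.cobounded1 min.cobounded2 max.cobounded1 max.cobounded2)+
  then show ?thesis by metis
qed

text \<open>A longest block through \<open>i\<close> is maximal under inclusion; lengths are bounded
  because no block reaches beyond \<open>N\<close>.\<close>

lemma increasing_run_exists:
  assumes "c i \<noteq> None" "\<forall>j\<ge>N. c j = None"
  obtains a b where "increasing_run c a b" "a \<le> i" "i < b"
proof -
  define Q where "Q = (\<lambda>(a, b). increasing_block c a b \<and> a \<le> i \<and> i < b)"
  have Q: "Q (i, Suc i)" using assms by (auto simp: Q_def increasing_block_iff)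
  have le: "b \<le> N" if "increasing_block c a b" for a b
  proof -
    have "b - 1 \<in> {a..<b}" using that by (auto simp: increasing_block_iff)
    then have "c (b - 1) \<noteq> None" using that unfolding increasing_block_iff by blast
    then have "b - 1 < N" using assms(2) by (meson not_less)
    then show ?thesis by linarith
  qed
  have "\<forall>y. Q y \<longrightarrow> snd y - fst y < Suc N"
    using le by (fastforce simp: Q_def)
  from ex_has_greatest_nat[of Q _ "\<lambda>y. snd y - fst y", OF Q this]
  obtain x where x: "Q x" "\<forall>y. Q y \<longrightarrow> snd y - fst y \<le> snd x - fst x"
    by blast
  obtain a b where ab: "x = (a, b)" by (cases x)
  have "a' = a \<and> b' = b" if "a' \<le> a \<and> b \<le> b' \<and> increasing_block c a' b'" for a' b'
  proof -
    have "Q (a', b')" using that x(1) by (auto simp: Q_def ab)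
    then have "b' - a' \<le> b - a" using x(2) ab by fastforce
    moreover have "a < b" using x(1) by (auto simp: Q_def ab)
    ultimately show ?thesis using that by linarith
  qed
  then have "increasing_run c a b" using x(1) by (auto simp: increasing_run_def Q_def ab)
  then show thesis using that x(1) by (auto simp: Q_def ab)
qed

text \<open>The left border \<open>m\<close> moves to the end of the leftmost block. Boxes in front
  of that block are empty, since a ball there would lie in some block and none starts
  earlier.\<close>

lemma concat_block_labels:
  assumes "sorted_wrt (<) as" "\<forall>a\<in>set as. m \<le> a \<and> a < e a \<and> e a \<le> N"
    "\<forall>a\<in>set as. \<forall>i\<in>{a..<e a}. c i \<noteq> None"
    "\<forall>i\<in>{m..<N}. c i \<noteq> None \<longrightarrow> (\<exists>a\<in>set as. i \<in> {a..<e a})"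
    "\<forall>a\<in>set as. \<forall>a'\<in>set as. a < a' \<longrightarrow> e a \<le> a'"
  shows "concat (map (\<lambda>a. block_labels c a (e a)) as) = ball_word c m N"
  using assms
proof (induction as arbitrary: m)
  case Nil
  then show ?case by (auto simp: ball_word_empty)
next
  case (Cons a as)
  have a: "m \<le> a" "a < e a" "e a \<le> N" using Cons.prems(2) by auto
  have gap: "c i = None" if "i \<in> {m..<a}" for i
  proof (rule ccontr)
    assume "c i \<noteq> None"
    moreover have "i \<in> {m..<N}" using that a by auto
    ultimately obtain a' where "a' \<in> set (a # as)" "i \<in> {a'..<e a'}" using Cons.prems(4) by blast
    then show False using that Cons.prems(1) by auto
  qed
  have "concat (map (\<lambda>a. block_labels c a (e a)) as) = ball_word c (e a) N"
  proof (rule Cons.IH)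
    show "\<forall>a'\<in>set as. e a \<le> a' \<and> a' < e a' \<and> e a' \<le> N"
      using Cons.prems(1,2,5) by auto
    show "\<forall>i\<in>{e a..<N}. c i \<noteq> None \<longrightarrow> (\<exists>a\<in>set as. i \<in> {a..<e a})"
      using Cons.prems(4) a by fastforce
  qed (use Cons.prems in auto)
  moreover have "ball_word c m N = ball_word c m a @ ball_word c a (e a) @ ball_word c (e a) N"
    using a ball_word_append[of m a N c] ball_word_append[of a "e a" N c] by simp
  ultimately show ?case
    using gap Cons.prems(3) by (simp add: ball_word_empty ball_word_full)
qed

lemma run_list:
  assumes "\<forall>j\<ge>N. c j = None"
  shows "concat (run_list c) = ball_word c 0 N"
    and "r \<in> set (run_list c) \<Longrightarrow> r \<noteq> [] \<and> sorted_wrt (<) r"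
proof -
  define S where "S = {a. \<exists>b. increasing_run c a b}"
  define e where "e a = (THE b. increasing_run c a b)" for a
  have runs: "run_list c = map (\<lambda>a. block_labels c a (e a)) (sorted_list_of_set S)"
    by (simp add: run_list_def S_def e_def)
  have less: "a < b" if "increasing_run c a b" for a b
    using that by (auto simp: increasing_run_def increasing_block_def)
  have uniq: "b = b'" if "increasing_run c a b" "increasing_run c a b'" for a b b'
    using increasing_run_unique[OF that] less that by blast
  have e: "increasing_run c a (e a)" if "a \<in> S" for a
    unfolding e_def using that uniq by (auto simp: S_def intro: theI)
  have e_eq: "e a = b" if "increasing_run c a b" for a b
    using that uniq by (auto simp: e_def)
  have le: "e a \<le> N" if "a \<in> S" for a
  proof (rule ccontr)
    assume *: "\<not> e a \<le> N"
    \<comment> \<open>A run reaching beyond \<open>N\<close> would contain this box, which is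
      empty.\<close>
    then have "max a N \<in> {a..<e a}" using less[OF e[OF that]] by auto
    then have "c (max a N) \<noteq> None"
      using e[OF that] unfolding increasing_run_def increasing_block_def by blast
    then show False using assms by simp
  qed
  have "S \<subseteq> {..N}" using le less e by (meson atMost_iff less_imp_le_nat order_trans subsetI)
  then have fin: "finite S" using finite_subset by blast
  show "concat (run_list c) = ball_word c 0 N"
    unfolding runs
  proof (rule concat_block_labels)
    show "\<forall>a\<in>set (sorted_list_of_set S). 0 \<le> a \<and> a < e a \<and> e a \<le> N"
      using fin e le less by auto
    show "\<forall>a\<in>set (sorted_list_of_set S). \<forall>i\<in>{a..<e a}. c i \<noteq> None"
      using fin e unfolding increasing_run_def increasing_block_def by auto
    show "\<forall>i\<in>{0..<N}. c i \<noteq> None \<longrightarrow> (\<exists>a\<in>set (sorted_list_of_set S). i \<in> {a..<e a})"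
    proof (intro ballI impI)
      fix i assume "c i \<noteq> None"
      then obtain a b where "increasing_run c a b" "a \<le> i" "i < b"
        using increasing_run_exists assms by metis
      then show "\<exists>a\<in>set (sorted_list_of_set S). i \<in> {a..<e a}"
        using e_eq fin by (auto simp: S_def)
    qed
    show "\<forall>a\<in>set (sorted_list_of_set S). \<forall>a'\<in>set (sorted_list_of_set S). a < a' \<longrightarrow> e a \<le> a'"
    proof (intro ballI impI)
      fix a a' assume "a \<in> set (sorted_list_of_set S)" "a' \<in> set (sorted_list_of_set S)" "a < a'"
      then have "increasing_run c a (e a)" "increasing_run c a' (e a')" "a < e a'"
        using e fin less by (auto intro: order.strict_trans)
      then show "e a \<le> a'" using increasing_run_unique \<open>a < a'\<close> by (metis less_irrefl not_less)
    qed
  qed simp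
  show "r \<noteq> [] \<and> sorted_wrt (<) r" if mem: "r \<in> set (run_list c)"
  proof -
    obtain a where "a \<in> S" "r = block_labels c a (e a)" using mem fin by (auto simp: runs)
    then show ?thesis using e[of a]
      by (auto simp: increasing_run_def increasing_block_def block_labels_def)
  qed
qed


section \<open>The soliton decomposition\<close>

text \<open>The multiset of entries supplies the labels and their distinctness, so only the
  comparison of adjacent rows is left, where shape and column conditions together amount to
  \<open>column_strict\<close>.\<close>

lemma standard_iff_semistandard:
  assumes "[] \<notin> set T" "\<forall>r\<in>set T. sorted_wrt (<) r" "mset (concat T) = mset_set {1..n}"
  shows "standard_tableau T \<longleftrightarrow> semistandard T"
proof
  assume T: "standard_tableau T"
  have "length (T ! Suc i) \<le> length (T ! i)" if "Suc i < length T" for i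
    using sorted_wrt_nth_less[of "(\<ge>)" "shape T" i "Suc i"] T that
    by (simp add: standard_tableau_def shape_def)
  then show "semistandard T"
    using T by (auto simp: standard_tableau_def semistandard_def successively_conv_nth
        column_strict_def strict_sorted_imp_sorted)
next
  assume T: "semistandard T"
  then have cols: "column_strict (T ! i) (T ! Suc i)" if "Suc i < length T" for i
    using that by (auto simp: semistandard_def successively_conv_nth)
  have "successively (\<ge>) (shape T)"
    using cols by (auto simp: successively_conv_nth shape_def column_strict_def)
  then have "sorted_wrt (\<ge>) (shape T)"
    by (simp add: successively_conv_sorted_wrt transp_on_def)
  moreover have set: "set (concat T) = {1..n}" "distinct (concat T)" "length (concat T) = n"
  proof -
    have "mset (concat T) = mset [1..<Suc n]"
      using assms(3) by (metis atLeastLessThanSuc_atLeastAtMost mset_upt)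
    then show "set (concat T) = {1..n}" "distinct (concat T)" "length (concat T) = n"
      by (metis atLeastLessThanSuc_atLeastAtMost mset_eq_setD set_upt,
          metis distinct_upt mset_eq_imp_distinct_iff,
          metis diff_Suc_1 length_upt mset_eq_length)
  qed
  ultimately show "standard_tableau T"
    using assms(1,2) cols unfolding standard_tableau_def set by (simp add: column_strict_def)
qed

theorem theorem4p2:
  fixes w :: "nat list" and n :: nat
  assumes "w \<in> permutations_of_set {1..n}"
  shows "(SD w = P_tableau w \<longleftrightarrow> standard_tableau (SD w)) \<and>
         (standard_tableau (SD w) \<longleftrightarrow> shape (SD w) = shape (P_tableau w))"
proof -
  define c where "c = bbs_state w (SOME t. steady_state w t)"
  have SD: "SD w = rev (run_list c)" by (simp add: SD_def c_def)
  obtain p M where p: "represents n c p" "\<forall>N\<ge>M. P_tableau (ball_word c 0 N) = P_tableau w"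
    using P_tableau_bbs_state[OF assms] unfolding c_def by blast
  obtain M' where "\<forall>i\<ge>M'. c i = None" using represents_bound[OF p(1)] by blast
  then have empty: "\<forall>i\<ge>max M M'. c i = None" by simp
  \<comment> \<open>The rows of \<open>SD w\<close> are the runs from right to left, so its reading
    word is the ball word of \<open>c\<close>.\<close>
  have P: "P_tableau (concat (rev (SD w))) = P_tableau w"
    using run_list(1)[OF empty] p(2) by (simp add: SD)
  have rows: "[] \<notin> set (SD w)" "\<forall>r\<in>set (SD w). sorted_wrt (<) r"
    using run_list(2)[OF empty] by (auto simp: SD)
  have "mset (concat (SD w)) = mset (concat (rev (SD w)))"
    by (simp add: mset_concat flip: rev_map)
  also have "\<dots> = mset w" by (metis P mset_concat_P_tableau)
  also have "\<dots> = mset_set {1..n}"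
    using assms by (metis permutations_of_setD mset_set_set)
  finally have standard: "standard_tableau (SD w) \<longleftrightarrow> semistandard (SD w)"
    using standard_iff_semistandard rows by blast
  have "SD w = P_tableau w" if "semistandard (SD w)"
    using P_tableau_reading_word[OF that] P by simp
  moreover have "semistandard (SD w)" if "shape (SD w) = shape (P_tableau w)"
    using semistandard_if_shape_P_tableau[of "SD w"] rows that P
    by (simp add: strict_sorted_imp_sorted)
  \<comment> \<open>Since \<open>P_tableau w\<close> is semistandard, so is \<open>SD w\<close> if
    the two are equal; this closes the cycle of implications.\<close>
  ultimately show ?thesis using standard semistandard_P_tableau by metis
qed

end
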